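(* Let $(\Omega,\sigma,\mathbb P)$ be an ergodic measure preserving system with $\sigma$ invertible on a Lebesgue probability space, and let $(f_n)_{n\in\mathbb N}\subseteq L^1(\Omega)$ be a subadditive sequence of functions, i.e. $f_{m+n}(\omega)\le f_m(\sigma^n\omega)+f_n(\omega)$ for all $m,n\in\mathbb N$. Then $$\tfrac1{2n}f_{2n}(\sigma^{-n}\omega)\to C=\lim_{n\to\infty}\tfrac1n\int_\Omega f_n\,d\mathbb P\in[-\infty,\infty)$$ as $n\to\infty$, for almost every $\omega\in\Omega$.
   Context: Functions are real valued and measurable. The limit $C$ exists in $[-\infty,\infty)$ by subadditivity of the sequence $\int f_n$. *)

theory Defs
  imports "HOL-Probability.Probability"
begin

(* The model of Rokhlin's theory: the interval [0, s] with Lebesgue measure, together with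
   atoms of masses p a at the points a of the countable set A outside the interval.
   Every subset of A is Lebesgue measurable, so the measurable sets are exactly the unions
   of a Lebesgue measurable subset of [0, s] and an arbitrary set of atoms. *)
definition interval_with_atoms :: "real \<Rightarrow> real set \<Rightarrow> (real \<Rightarrow> ennreal) \<Rightarrow> real measure" where
  "interval_with_atoms s A p =
     measure_of ({0..s} \<union> A) (sets (lebesgue_on ({0..s} \<union> A)))
       (\<lambda>E. emeasure lebesgue (E \<inter> {0..s}) + (\<integral>\<^sup>+ a. p a \<partial>count_space (E \<inter> A)))"

(* measure_of yields the zero measure if its argument is not countably additive;
   the next two lemmas show that this does not happen here. *)
lemma sets_interval_with_atoms:
  "sets (interval_with_atoms s A p) = sets (lebesgue_on ({0..s} \<union> A))"
  unfolding interval_with_atoms_def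
  using sets.sigma_sets_eq[of "lebesgue_on ({0..s} \<union> A)"]
        sets.space_closed[of "lebesgue_on ({0..s} \<union> A)"]
  by (simp add: space_restrict_space)

lemma emeasure_interval_with_atoms:
  assumes A: "countable A" and E: "E \<in> sets (lebesgue_on ({0..s} \<union> A))"
  shows "emeasure (interval_with_atoms s A p) E =
           emeasure lebesgue (E \<inter> {0..s}) + (\<integral>\<^sup>+ a. p a \<partial>count_space (E \<inter> A))"
proof -
  let ?Y = "{0..s} \<union> A"
  let ?\<mu> = "\<lambda>E. emeasure lebesgue (E \<inter> {0..s}) + (\<integral>\<^sup>+ a. p a \<partial>count_space (E \<inter> A))"
  let ?D = "density (count_space UNIV) (\<lambda>a. p a * indicator A a)"
  have Asets: "A \<in> sets lebesgue"
    using null_setsD2[OF countable_imp_null_set_lborel[OF A]] by simp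
  have Ysets: "?Y \<in> sets lebesgue" using Asets by auto
  have D: "(\<integral>\<^sup>+ a. p a \<partial>count_space (B \<inter> A)) = emeasure ?D B" for B
  proof -
    have "(\<integral>\<^sup>+ a. p a \<partial>count_space (B \<inter> A))
        = (\<integral>\<^sup>+ a. p a * indicator (B \<inter> A) a \<partial>count_space UNIV)"
      using nn_integral_restrict_space[of "B \<inter> A" "count_space UNIV" p]
      by (simp add: restrict_count_space)
    also have "\<dots> = emeasure ?D B"
      by (simp add: emeasure_density)
         (intro nn_integral_cong, auto simp: indicator_def)
    finally show ?thesis .
  qed
  have "countably_additive (sets (lebesgue_on ?Y)) ?\<mu>"
  proof (rule countably_additiveI)
    fix B :: "nat \<Rightarrow> real set"
    assume B: "range B \<subseteq> sets (lebesgue_on ?Y)" "disjoint_family B"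
    have BL: "B i \<inter> {0..s} \<in> sets lebesgue" for i
    proof -
      have "B i \<in> sets (lebesgue_on ?Y)" using B(1) by blast
      then have "B i \<in> sets lebesgue" using Ysets by (simp add: sets_restrict_space_iff)
      then show ?thesis by (intro sets.Int) auto
    qed
    have "(\<Sum>i. emeasure lebesgue (B i \<inter> {0..s})) = emeasure lebesgue (\<Union>i. B i \<inter> {0..s})"
      using B(2) BL by (intro suminf_emeasure) (auto simp: disjoint_family_on_def)
    moreover have "(\<Sum>i. emeasure ?D (B i)) = emeasure ?D (\<Union>i. B i)"
      using B(2) by (intro suminf_emeasure) auto
    ultimately show "(\<Sum>i. ?\<mu> (B i)) = ?\<mu> (\<Union>i. B i)"
      by (simp add: D flip: suminf_add)
  qed
  moreover have "positive (sets (lebesgue_on ?Y)) ?\<mu>" by (simp add: positive_def nn_integral_empty)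
  ultimately show ?thesis
    unfolding interval_with_atoms_def
    using E sets.space_closed[of "lebesgue_on ?Y"] sets.sigma_sets_eq[of "lebesgue_on ?Y"]
    by (intro emeasure_measure_of[OF refl]) (auto simp: space_restrict_space)
qed

definition isomorphic_mod_0 :: "'a measure \<Rightarrow> 'b measure \<Rightarrow> bool" where
  "isomorphic_mod_0 M N \<longleftrightarrow>
     (\<exists>X Y \<phi>. X \<in> sets M \<and> space M - X \<in> null_sets M \<and>
              Y \<in> sets N \<and> space N - Y \<in> null_sets N \<and>
              bij_betw \<phi> X Y \<and>
              \<phi> \<in> measurable (restrict_space M X) (restrict_space N Y) \<and>
              inv_into X \<phi> \<in> measurable (restrict_space N Y) (restrict_space M X) \<and>
              distr (restrict_space M X) (restrict_space N Y) \<phi> = restrict_space N Y)"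

definition lebesgue_prob_space :: "'a measure \<Rightarrow> bool" where
  "lebesgue_prob_space M \<longleftrightarrow>
     prob_space M \<and> complete_measure M \<and>
     (\<exists>s A p. 0 \<le> s \<and> countable A \<and> A \<inter> {0..s} = {} \<and> (\<forall>a\<in>A. 0 < p a) \<and>
              isomorphic_mod_0 M (interval_with_atoms s A p))"

definition measure_preserving :: "'a measure \<Rightarrow> ('a \<Rightarrow> 'a) \<Rightarrow> bool" where
  "measure_preserving M T \<longleftrightarrow> T \<in> measurable M M \<and> distr M M T = M"

definition invertible_measure_preserving :: "'a measure \<Rightarrow> ('a \<Rightarrow> 'a) \<Rightarrow> bool" where
  "invertible_measure_preserving M T \<longleftrightarrow>
     measure_preserving M T \<and> bij_betw T (space M) (space M) \<and>
     inv_into (space M) T \<in> measurable M M"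

definition ergodic :: "'a measure \<Rightarrow> ('a \<Rightarrow> 'a) \<Rightarrow> bool" where
  "ergodic M T \<longleftrightarrow>
     measure_preserving M T \<and>
     (\<forall>A\<in>sets M. T -` A \<inter> space M = A \<longrightarrow> measure M A = 0 \<or> measure M A = 1)"

(* The functions are elements of L^1, hence the inequality is only required almost everywhere;
   the index set consists of the positive integers. *)
definition subadditive_sequence ::
    "'a measure \<Rightarrow> ('a \<Rightarrow> 'a) \<Rightarrow> (nat \<Rightarrow> 'a \<Rightarrow> real) \<Rightarrow> bool" where
  "subadditive_sequence M T f \<longleftrightarrow>
     (\<forall>m\<ge>1. \<forall>n\<ge>1. AE \<omega> in M. f (m + n) \<omega> \<le> f m ((T ^^ n) \<omega>) + f n \<omega>)"

end

theory Submission
  imports Defs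
begin

text \<open>
  Write \<open>F\<^sub>x(a, b) = f\<^sub>b\<^sub>-\<^sub>a(\<sigma>\<^sup>a x)\<close> for the value of the sequence on the piece of the orbit of \<open>x\<close> between
  the times \<open>a < b\<close>. For almost every \<open>x\<close> this is a subadditive function of integer intervals, and
  the theorem says that \<open>F\<^sub>x(-n, n) / 2n\<close> tends to \<open>C\<close>, which by Fekete's lemma is the infimum of
  \<open>c\<^sub>L = \<integral> f\<^sub>L / L\<close>.

  For a fixed length \<open>L\<close>, cut the window \<open>[-n, n)\<close> into blocks of length \<open>L\<close> and average over
  the \<open>L\<close> possible positions of the cuts. The sum over the blocks becomes \<open>1 / L\<close> times the sum of \<open>f\<^sub>L\<close> over
  the orbit segment from \<open>-n\<close> to \<open>n\<close>, which is asymptotic to \<open>2n c\<^sub>L\<close> by the ergodic theorem applied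
  to \<open>\<sigma>\<close> and to its inverse (\<open>symmetric_birkhoff\<close>). Subadditivity then gives the upper bound
  \<open>limsup F\<^sub>x(-n, n) / 2n \<le> c\<^sub>L\<close> for every \<open>L\<close>, hence the upper bound \<open>C\<close> (\<open>AE_upper\<close>); if \<open>C\<close> is
  \<open>-\<infinity>\<close>, nothing else remains to be shown.

  For the lower bound with finite \<open>C\<close>, consider what is lost by this estimate: the sum over the
  blocks minus the value on the window, averaged over the positions of the cuts (\<open>block_defect\<close>
  is the total over the positions). It is nonnegative and superadditive, and its mean grows like
  \<open>c\<^sub>L - C\<close> times the length of the window. A maximal inequality for such processes on symmetric
  windows (\<open>maximal_inequality\<close>), proved by a covering argument of Vitali type along orbits
  (\<open>superadditive_covering\<close>), shows that outside a set of probability at most \<open>2 (c\<^sub>L - C) / \<theta>\<close> the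
  loss is at most \<open>\<theta>\<close> times the length, simultaneously for all windows made of an even number of
  blocks. Outside this set \<open>liminf F\<^sub>x(-n, n) / 2n \<ge> c\<^sub>L - \<theta> \<ge> C - \<theta>\<close>. As \<open>L\<close> grows, the probability
  tends to \<open>0\<close>, and \<open>\<theta>\<close> is arbitrary (\<open>AE_lower\<close>).

  The ergodic theorem itself is proved by comparing the maximal orbit sums of a function with their
  composition with the transformation (\<open>birkhoff_sums_bounded_above\<close>).
\<close>

section \<open>The ergodic theorem\<close>

lemma measure_preserving_measurable:
  "measure_preserving M T \<Longrightarrow> T \<in> measurable M M"
  unfolding measure_preserving_def by (rule conjunct1)

lemma measure_preserving_distr:
  "measure_preserving M T \<Longrightarrow> distr M M T = M"
  unfolding measure_preserving_def by (rule conjunct2)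

lemma measure_preserving_integrable:
  fixes g :: "'a \<Rightarrow> real"
  assumes T: "measure_preserving M T" and g: "integrable M g"
  shows "integrable M (\<lambda>x. g (T x))"
  by (rule integrable_distr[OF measure_preserving_measurable[OF T]])
     (subst measure_preserving_distr[OF T], rule g)

lemma measure_preserving_integral:
  fixes g :: "'a \<Rightarrow> real"
  assumes T: "measure_preserving M T" and g: "g \<in> borel_measurable M"
  shows "(\<integral>x. g (T x) \<partial>M) = (\<integral>x. g x \<partial>M)"
  using integral_distr[OF measure_preserving_measurable[OF T] g]
  unfolding measure_preserving_distr[OF T] by (rule sym)

lemma measure_preserving_AE:
  assumes T: "measure_preserving M T" and P: "AE x in M. P x"
  shows "AE x in M. P (T x)"
  by (rule AE_distrD[OF measure_preserving_measurable[OF T]])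
     (subst measure_preserving_distr[OF T], rule P)

text \<open>In closed form this is \<open>max {S\<^sub>0, ..., S\<^sub>n}\<close>, where \<open>S\<^sub>k\<close> is the sum of \<open>g\<close> over the first
\<open>k\<close> points of the orbit. The recursion along the orbit is the form in which the function is
compared with its composition with \<open>T\<close>.\<close>

fun excess :: "('a \<Rightarrow> 'a) \<Rightarrow> ('a \<Rightarrow> real) \<Rightarrow> nat \<Rightarrow> 'a \<Rightarrow> real" where
  "excess T g 0 x = 0"
| "excess T g (Suc n) x = max 0 (g x + excess T g n (T x))"

lemma excess_nonneg: "0 \<le> excess T g n x"
  by (cases n) auto

lemma excess_Suc_mono: "excess T g n x \<le> excess T g (Suc n) x"
proof (induction n arbitrary: x)
  case (Suc n)
  have "excess T g (Suc n) x = max 0 (g x + excess T g n (T x))"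
    by simp
  also have "\<dots> \<le> max 0 (g x + excess T g (Suc n) (T x))"
    using Suc.IH[of "T x"] by (intro max.mono add_mono) auto
  also have "\<dots> = excess T g (Suc (Suc n)) x"
    by (simp only: excess.simps(2)[of T g "Suc n" x])
  finally show ?case .
qed simp

lemma excess_mono: "m \<le> n \<Longrightarrow> excess T g m x \<le> excess T g n x"
  by (rule lift_Suc_mono_le[of "\<lambda>n. excess T g n x"]) (rule excess_Suc_mono)

lemma birkhoff_sum_le_excess: "(\<Sum>i<n. g ((T ^^ i) x)) \<le> excess T g n x"
proof (induction n arbitrary: x)
  case (Suc n)
  have "(\<Sum>i<Suc n. g ((T ^^ i) x)) = g x + (\<Sum>i<n. g ((T ^^ i) (T x)))"
    by (subst sum.lessThan_Suc_shift) (simp add: funpow_swap1)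
  also have "\<dots> \<le> g x + excess T g n (T x)"
    using Suc.IH[of "T x"] by simp
  finally show ?case by simp
qed simp

lemma integrable_excess:
  assumes T: "measure_preserving M T" and g: "integrable M g"
  shows "integrable M (excess T g n)"
proof (induction n)
  case 0
  have "excess T g 0 = (\<lambda>x. 0)" by (rule ext) simp
  then show ?case by (simp del: excess.simps)
next
  case (Suc n)
  have "integrable M (\<lambda>x. excess T g n (T x))"
    by (rule measure_preserving_integrable[OF T Suc])
  then have "integrable M (\<lambda>x. max 0 (g x + excess T g n (T x)))"
    using g by (intro integrable_max Bochner_Integration.integrable_add) auto
  moreover have "excess T g (Suc n) = (\<lambda>x. max 0 (g x + excess T g n (T x)))"
    by (rule ext) simp
  ultimately show ?case by (simp only:)
qed

text \<open>The points at which the maximal sums \<open>m\<^sub>n\<close> are unbounded form an invariant set. If it had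
full measure, then \<open>m\<^sub>n\<^sub>+\<^sub>1 - m\<^sub>n \<circ> T = max (- m\<^sub>n \<circ> T) g\<close> would tend to \<open>g\<close> almost everywhere,
dominated by \<open>\<bar>g\<bar>\<close>. But these functions have nonnegative integrals, because \<open>T\<close> preserves
the integral of \<open>m\<^sub>n\<close> and \<open>m\<^sub>n \<le> m\<^sub>n\<^sub>+\<^sub>1\<close>; so the integral of \<open>g\<close> would be nonnegative.\<close>

lemma birkhoff_sums_bounded_above:
  fixes g :: "'a \<Rightarrow> real"
  assumes "prob_space M" and erg: "ergodic M T" and g: "integrable M g"
    and neg: "(\<integral>x. g x \<partial>M) < 0"
  shows "AE x in M. \<exists>B. \<forall>n. (\<Sum>i<n. g ((T ^^ i) x)) \<le> B"
proof -
  interpret prob_space M by fact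
  have T: "measure_preserving M T" using erg by (simp add: ergodic_def)
  have Tm[measurable]: "T \<in> measurable M M" by (rule measure_preserving_measurable[OF T])
  note gm[measurable] = borel_measurable_integrable[OF g]
  note em[measurable] = borel_measurable_integrable[OF integrable_excess[OF T g]]
  define A where "A = {x \<in> space M. \<forall>B::nat. \<exists>n. real B < excess T g n x}"
  have Am: "A \<in> sets M" unfolding A_def by measurable
  have inv: "T x \<in> A \<longleftrightarrow> x \<in> A" if x: "x \<in> space M" for x
  proof
    assume Tx: "T x \<in> A"
    have "\<exists>n. real B < excess T g n x" for B
    proof -
      obtain n where "real (B + nat \<lceil>\<bar>g x\<bar>\<rceil>) < excess T g n (T x)"
        using Tx unfolding A_def by blast
      then have "real B < g x + excess T g n (T x)"
        using real_nat_ceiling_ge[of "\<bar>g x\<bar>"] by simp linarith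
      then have "real B < excess T g (Suc n) x" by simp
      then show ?thesis by blast
    qed
    then show "x \<in> A" using x by (simp add: A_def)
  next
    assume xA: "x \<in> A"
    have "\<exists>n. real B < excess T g n (T x)" for B
    proof -
      obtain n where n: "real (B + nat \<lceil>\<bar>g x\<bar>\<rceil>) < excess T g n x"
        using xA unfolding A_def by blast
      then have "real (B + nat \<lceil>\<bar>g x\<bar>\<rceil>) < excess T g (Suc n) x"
        using excess_Suc_mono[of T g n x] by linarith
      then have "real B + real (nat \<lceil>\<bar>g x\<bar>\<rceil>) < max 0 (g x + excess T g n (T x))"
        by simp
      then have "real B < excess T g n (T x)"
        using real_nat_ceiling_ge[of "\<bar>g x\<bar>"] unfolding less_max_iff_disj by linarith
      then show ?thesis by blast
    qed
    then show "T x \<in> A" using x measurable_space[OF Tm] by (simp add: A_def)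
  qed
  have "T -` A \<inter> space M = A" using inv by (auto simp: A_def)
  then have "prob A = 0 \<or> prob A = 1" using erg Am by (simp add: ergodic_def)
  moreover have "prob A \<noteq> 1"
  proof
    assume "prob A = 1"
    then have AE_A: "AE x in M. x \<in> A" using Am prob_eq_1 by blast
    have lim: "(\<lambda>n. \<integral>x. excess T g (Suc n) x - excess T g n (T x) \<partial>M) \<longlonglongrightarrow> (\<integral>x. g x \<partial>M)"
    proof (rule integral_dominated_convergence[where w = "\<lambda>x. \<bar>g x\<bar>"])
      show "AE x in M. (\<lambda>n. excess T g (Suc n) x - excess T g n (T x)) \<longlonglongrightarrow> g x"
        using AE_A
      proof eventually_elim
        case (elim x)
        then have "T x \<in> A" using inv[of x] by (auto simp: A_def)
        then obtain N where N: "real (nat \<lceil>\<bar>g x\<bar>\<rceil>) < excess T g N (T x)"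
          unfolding A_def by blast
        have "excess T g (Suc n) x - excess T g n (T x) = g x" if "n \<ge> N" for n
        proof -
          have "0 \<le> g x + excess T g n (T x)"
            using N excess_mono[OF that, of T g "T x"] real_nat_ceiling_ge[of "\<bar>g x\<bar>"]
            by linarith
          then show ?thesis by simp
        qed
        then show ?case
          by (intro tendsto_eventually) (auto simp: eventually_sequentially simp del: excess.simps)
      qed
      show "AE x in M. norm (excess T g (Suc n) x - excess T g n (T x)) \<le> \<bar>g x\<bar>" for n
      proof (rule AE_I2)
        fix x
        show "norm (excess T g (Suc n) x - excess T g n (T x)) \<le> \<bar>g x\<bar>"
          using excess_nonneg[of T g n "T x"] by (auto simp: max_def)
      qed
    qed (use g in auto)
    have "0 \<le> (\<integral>x. excess T g (Suc n) x - excess T g n (T x) \<partial>M)" for n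
    proof -
      have "(\<integral>x. excess T g n (T x) \<partial>M) = (\<integral>x. excess T g n x \<partial>M)"
        by (rule measure_preserving_integral[OF T em])
      moreover have "(\<integral>x. excess T g n x \<partial>M) \<le> (\<integral>x. excess T g (Suc n) x \<partial>M)"
        by (intro integral_mono integrable_excess[OF T g] excess_Suc_mono)
      ultimately show ?thesis
        using integrable_excess[OF T g, of "Suc n"]
          measure_preserving_integrable[OF T integrable_excess[OF T g, of n]]
        by (simp del: excess.simps)
    qed
    then have "0 \<le> (\<integral>x. g x \<partial>M)"
      by (intro LIMSEQ_le_const[OF lim]) auto
    then show False using neg by simp
  qed
  ultimately have "prob A = 0" by blast
  then have "AE x in M. x \<notin> A"
    using Am by (intro AE_not_in) (simp add: null_sets_def emeasure_eq_measure)
  with AE_space show ?thesis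
  proof eventually_elim
    case (elim x)
    then obtain B :: nat where "\<forall>n. excess T g n x \<le> real B"
      by (auto simp: A_def not_less)
    then have "\<forall>n. (\<Sum>i<n. g ((T ^^ i) x)) \<le> real B"
      using birkhoff_sum_le_excess[of g T] order_trans by blast
    then show ?case by blast
  qed
qed

text \<open>After subtracting a constant slightly larger than its integral, \<open>g\<close> has a negative integral, so
its orbit sums are bounded above and contribute nothing to the averages in the limit.\<close>

lemma birkhoff_averages_eventually_less:
  fixes g :: "'a \<Rightarrow> real"
  assumes "prob_space M" and erg: "ergodic M T" and g: "integrable M g"
  shows "AE x in M. \<forall>\<epsilon>>0. \<forall>\<^sub>F n in sequentially.
           (\<Sum>i<n. g ((T ^^ i) x)) / real n < (\<integral>x. g x \<partial>M) + \<epsilon>"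
proof -
  interpret prob_space M by fact
  define c where "c = (\<integral>x. g x \<partial>M)"
  have "AE x in M. \<forall>k::nat. \<exists>B. \<forall>n. (\<Sum>i<n. g ((T ^^ i) x) - (c + 1 / real (Suc k))) \<le> B"
    unfolding AE_all_countable
  proof
    fix k :: nat
    show "AE x in M. \<exists>B. \<forall>n. (\<Sum>i<n. g ((T ^^ i) x) - (c + 1 / real (Suc k))) \<le> B"
      using g by (intro birkhoff_sums_bounded_above[OF \<open>prob_space M\<close> erg])
        (auto simp: prob_space c_def)
  qed
  then show ?thesis
  proof eventually_elim
    case (elim x)
    show ?case
    proof (intro allI impI)
      fix \<epsilon> :: real assume "\<epsilon> > 0"
      then obtain k :: nat where k: "1 / real (Suc k) < \<epsilon> / 2"
        using nat_approx_posE[of "\<epsilon> / 2"] by auto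
      obtain B where B: "(\<Sum>i<n. g ((T ^^ i) x) - (c + 1 / real (Suc k))) \<le> B" for n
        using elim by blast
      have "(\<lambda>n. B / real n) \<longlonglongrightarrow> 0" by (rule lim_const_over_n)
      then have "\<forall>\<^sub>F n in sequentially. B / real n < \<epsilon> / 2"
        using \<open>\<epsilon> > 0\<close> by (intro order_tendstoD) auto
      with eventually_gt_at_top[of 0]
      show "\<forall>\<^sub>F n in sequentially. (\<Sum>i<n. g ((T ^^ i) x)) / real n < (\<integral>x. g x \<partial>M) + \<epsilon>"
      proof eventually_elim
        case (elim n)
        have "(\<Sum>i<n. g ((T ^^ i) x)) \<le> B + real n * (c + 1 / real (Suc k))"
          using B[of n] by (simp add: sum_subtractf)
        then have "(\<Sum>i<n. g ((T ^^ i) x)) / real n \<le> B / real n + (c + 1 / real (Suc k))"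
          using divide_right_mono[of _ _ "real n"] elim(1)
          by (fastforce simp: add_divide_distrib)
        then show ?case using elim k unfolding c_def by linarith
      qed
    qed
  qed
qed

theorem birkhoff:
  fixes g :: "'a \<Rightarrow> real"
  assumes "prob_space M" and erg: "ergodic M T" and g: "integrable M g"
  shows "AE x in M. (\<lambda>n. (\<Sum>i<n. g ((T ^^ i) x)) / real n) \<longlonglongrightarrow> (\<integral>x. g x \<partial>M)"
proof -
  have g': "integrable M (\<lambda>x. - g x)" using g by simp
  show ?thesis
    using birkhoff_averages_eventually_less[OF assms]
      birkhoff_averages_eventually_less[OF assms(1,2) g']
  proof eventually_elim
    case (elim x)
    show ?case
    proof (rule order_tendstoI)
      fix a assume "a < (\<integral>x. g x \<partial>M)"
      then have "\<forall>\<^sub>F n in sequentially. (\<Sum>i<n. - g ((T ^^ i) x)) / real n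
          < (\<integral>x. - g x \<partial>M) + ((\<integral>x. g x \<partial>M) - a)"
        using elim(2) by (meson diff_gt_0_iff_gt)
      then show "\<forall>\<^sub>F n in sequentially. a < (\<Sum>i<n. g ((T ^^ i) x)) / real n"
        by eventually_elim (simp add: sum_negf)
    next
      fix a assume "(\<integral>x. g x \<partial>M) < a"
      then have "\<forall>\<^sub>F n in sequentially. (\<Sum>i<n. g ((T ^^ i) x)) / real n
          < (\<integral>x. g x \<partial>M) + (a - (\<integral>x. g x \<partial>M))"
        using elim(1) by (meson diff_gt_0_iff_gt)
      then show "\<forall>\<^sub>F n in sequentially. (\<Sum>i<n. g ((T ^^ i) x)) / real n < a"
        by simp
    qed
  qed
qed

section \<open>Fekete's lemma\<close>

text \<open>Splitting off blocks of length \<open>p\<close> shows that \<open>a n / n\<close> exceeds \<open>a p / p\<close> by at most a constant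
divided by \<open>n\<close>.\<close>

lemma fekete:
  fixes a :: "nat \<Rightarrow> real"
  assumes sub: "\<And>m n. m \<ge> 1 \<Longrightarrow> n \<ge> 1 \<Longrightarrow> a (m + n) \<le> a m + a n"
  shows "(\<lambda>n. ereal (a n / real n)) \<longlonglongrightarrow> (INF n\<in>{1..}. ereal (a n / real n))"
proof (rule order_tendstoI)
  fix l assume l: "l < (INF n\<in>{1..}. ereal (a n / real n))"
  show "\<forall>\<^sub>F n in sequentially. l < ereal (a n / real n)"
    using eventually_ge_at_top[of 1]
  proof eventually_elim
    case (elim n)
    then show ?case using l by (intro less_INF_D[OF l]) auto
  qed
next
  fix u assume "(INF n\<in>{1..}. ereal (a n / real n)) < u"
  then obtain p where p: "p \<ge> 1" "ereal (a p / real p) < u"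
    by (auto simp: INF_less_iff)
  obtain v where v: "ereal (a p / real p) < ereal v" "ereal v < u"
    using ereal_dense2[OF p(2)] by blast
  define B where "B = (\<Sum>r\<in>{1..2*p}. \<bar>a r\<bar>)"
  have step: "a (q * p + r) \<le> real q * a p + B" if "1 \<le> r" "r \<le> p" for q r
  proof (induction q)
    case 0
    have "\<bar>a r\<bar> \<le> B" unfolding B_def
      by (rule member_le_sum) (use that in auto)
    then show ?case by auto
  next
    case (Suc q)
    have "a (p + (q * p + r)) \<le> a p + a (q * p + r)"
      by (rule sub) (use p that in auto)
    then show ?case using Suc by (simp add: algebra_simps)
  qed
  have bound: "a n \<le> real n * (a p / real p) + (\<bar>a p\<bar> + B)" if "n \<ge> 1" for n
  proof -
    \<comment> \<open>The remainder is taken in \<open>{1..p}\<close> and not in \<open>{0..<p}\<close>, since \<open>a 0\<close> is arbitrary.\<close>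
    define q r where "q = (n - 1) div p" and "r = (n - 1) mod p + 1"
    have n: "n = q * p + r" using that unfolding q_def r_def by (simp add: mult.commute)
    have r: "1 \<le> r" "r \<le> p" using p(1) unfolding r_def by (auto simp: Suc_le_eq)
    have "real n * (a p / real p) = real q * a p + real r * a p / real p"
      using p(1) by (simp add: n field_simps)
    moreover have "\<bar>real r * a p / real p\<bar> \<le> \<bar>a p\<bar>"
      using r p(1) by (simp add: abs_mult field_simps mult_right_mono)
    moreover have "a n \<le> real q * a p + B" using step[OF r, of q] n by simp
    ultimately show ?thesis by linarith
  qed
  have "(\<lambda>n. (\<bar>a p\<bar> + B) / real n) \<longlonglongrightarrow> 0" by (rule lim_const_over_n)
  then have "\<forall>\<^sub>F n in sequentially. (\<bar>a p\<bar> + B) / real n < v - a p / real p"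
    using v(1) by (intro order_tendstoD) auto
  with eventually_ge_at_top[of 1]
  show "\<forall>\<^sub>F n in sequentially. ereal (a n / real n) < u"
  proof eventually_elim
    case (elim n)
    have "a n / real n \<le> a p / real p + (\<bar>a p\<bar> + B) / real n"
      using divide_right_mono[OF bound[OF elim(1)], of "real n"] elim(1)
      by (simp add: add_divide_distrib)
    then have "a n / real n < v" using elim(2) by linarith
    then show ?case using v(2) by (meson ereal_less_eq(3) less_ereal.simps(1) order.strict_trans)
  qed
qed

section \<open>Subadditive functions of integer intervals\<close>

definition interval_subadditive :: "(int \<Rightarrow> int \<Rightarrow> real) \<Rightarrow> bool" where
  "interval_subadditive F \<longleftrightarrow>
     (\<forall>a. F a a = 0) \<and> (\<forall>a b c. a \<le> b \<longrightarrow> b \<le> c \<longrightarrow> F a c \<le> F a b + F b c)"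

lemma interval_subadditiveD:
  "interval_subadditive F \<Longrightarrow> a \<le> b \<Longrightarrow> b \<le> c \<Longrightarrow> F a c \<le> F a b + F b c"
  by (simp add: interval_subadditive_def)

lemma sum_int_concat:
  fixes g :: "int \<Rightarrow> real"
  assumes "a \<le> b" "b \<le> c"
  shows "(\<Sum>i\<in>{a..<b}. g i) + (\<Sum>i\<in>{b..<c}. g i) = (\<Sum>i\<in>{a..<c}. g i)"
  using assms by (subst sum.union_disjoint[symmetric]) (auto intro!: sum.cong)

lemma interval_subadditive_le_sum_abs:
  assumes F: "interval_subadditive F" and "a \<le> b"
  shows "F a b \<le> (\<Sum>i\<in>{a..<b}. \<bar>F i (i + 1)\<bar>)"
  using \<open>a \<le> b\<close>
proof (induction b rule: int_ge_induct)
  case base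
  then show ?case using F by (simp add: interval_subadditive_def)
next
  case (step b)
  have "F a (b + 1) \<le> F a b + F b (b + 1)"
    by (rule interval_subadditiveD[OF F]) (use step in auto)
  moreover have "(\<Sum>i\<in>{a..<b + 1}. \<bar>F i (i + 1)\<bar>) = (\<Sum>i\<in>{a..<b}. \<bar>F i (i + 1)\<bar>) + \<bar>F b (b + 1)\<bar>"
  proof -
    have "{b..<b + 1} = {b}" by auto
    then show ?thesis using sum_int_concat[of a b "b + 1" "\<lambda>i. \<bar>F i (i + 1)\<bar>"] step by simp
  qed
  ultimately show ?case using step.IH by linarith
qed

text \<open>Enlarging an interval costs at most the sum of \<open>\<bar>F i (i + 1)\<bar>\<close> over the added points. That sum is
written as a difference of two symmetric sums over \<open>[-s, s)\<close> and \<open>[-r, r)\<close>: both grow at the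
same linear rate, so for \<open>s - r\<close> bounded the cost is of smaller order than the length of the interval.\<close>

lemma interval_subadditive_nested:
  fixes F :: "int \<Rightarrow> int \<Rightarrow> real"
  assumes F: "interval_subadditive F"
    and "0 \<le> r" "a \<le> a'" "a' \<le> - r" "r \<le> b'" "b' \<le> b" "- s \<le> a" "b \<le> s"
  shows "F a b \<le> F a' b' + ((\<Sum>i\<in>{-s..<s}. \<bar>F i (i + 1)\<bar>) - (\<Sum>i\<in>{-r..<r}. \<bar>F i (i + 1)\<bar>))"
proof -
  let ?e = "\<lambda>i. \<bar>F i (i + 1)\<bar>"
  have "F a b \<le> F a a' + F a' b" "F a' b \<le> F a' b' + F b' b"
    by (rule interval_subadditiveD[OF F]; use assms in linarith)+
  moreover have "F a a' \<le> (\<Sum>i\<in>{a..<a'}. ?e i)" "F b' b \<le> (\<Sum>i\<in>{b'..<b}. ?e i)"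
    by (rule interval_subadditive_le_sum_abs[OF F]; use assms in linarith)+
  moreover have "(\<Sum>i\<in>{a..<a'}. ?e i) \<le> (\<Sum>i\<in>{-s..<-r}. ?e i)"
      "(\<Sum>i\<in>{b'..<b}. ?e i) \<le> (\<Sum>i\<in>{r..<s}. ?e i)"
    by (rule sum_mono2; use assms in auto)+
  moreover have "(\<Sum>i\<in>{-s..<-r}. ?e i) + (\<Sum>i\<in>{-r..<r}. ?e i) = (\<Sum>i\<in>{-s..<r}. ?e i)"
      "(\<Sum>i\<in>{-s..<r}. ?e i) + (\<Sum>i\<in>{r..<s}. ?e i) = (\<Sum>i\<in>{-s..<s}. ?e i)"
    by (rule sum_int_concat; use assms in linarith)+
  ultimately show ?thesis by linarith
qed

text \<open>For each offset \<open>j\<close> the interval from \<open>j + a L\<close> to \<open>j + b L\<close> is cut into blocks of length \<open>L\<close>, and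
its value is compared with the sum of the values of its blocks; the function is the total loss over
all offsets. Summation over \<open>j\<close> lets the blocks start at every integer, so the first sum is an orbit
sum of a single function under the transformation itself and not under its \<open>L\<close>-th power, which
need not be ergodic.\<close>

definition block_defect :: "(int \<Rightarrow> int \<Rightarrow> real) \<Rightarrow> nat \<Rightarrow> int \<Rightarrow> int \<Rightarrow> real" where
  "block_defect F L a b =
     (\<Sum>i\<in>{a * int L..<b * int L}. F i (i + int L))
     - (\<Sum>j\<in>{0..<int L}. F (j + a * int L) (j + b * int L))"

lemma block_defect_superadditive:
  assumes F: "interval_subadditive F" and ab: "a \<le> b" "b \<le> c"
  shows "block_defect F L a b + block_defect F L b c \<le> block_defect F L a c"
proof -
  have m: "a * int L \<le> b * int L" "b * int L \<le> c * int L"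
    using ab by (auto intro: mult_right_mono)
  have "(\<Sum>j\<in>{0..<int L}. F (j + a * int L) (j + c * int L))
      \<le> (\<Sum>j\<in>{0..<int L}. F (j + a * int L) (j + b * int L) + F (j + b * int L) (j + c * int L))"
    by (intro sum_mono interval_subadditiveD[OF F]) (use m in auto)
  then show ?thesis
    using sum_int_concat[OF m, of "\<lambda>i. F i (i + int L)"]
    by (simp add: block_defect_def sum.distrib)
qed

lemma block_defect_single_block: "block_defect F L a (a + 1) = 0"
proof -
  have "(\<Sum>i\<in>{a * int L..<(a + 1) * int L}. F i (i + int L))
      = (\<Sum>j\<in>{0..<int L}. F (j + a * int L) (j + (a + 1) * int L))"
    by (rule sum.reindex_bij_witness[of _ "\<lambda>j. j + a * int L" "\<lambda>i. i - a * int L"])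
       (auto simp: algebra_simps)
  then show ?thesis by (simp add: block_defect_def)
qed

text \<open>Superadditivity adds up the defects of single blocks, which vanish.\<close>

lemma block_defect_nonneg:
  assumes F: "interval_subadditive F" and "a \<le> b"
  shows "0 \<le> block_defect F L a b"
  using \<open>a \<le> b\<close>
proof (induction b rule: int_ge_induct)
  case base
  then show ?case using F by (simp add: interval_subadditive_def block_defect_def)
next
  case (step b)
  then show ?case
    using block_defect_superadditive[OF F step.hyps, of "b + 1" L] block_defect_single_block[of F L b]
    by simp
qed

text \<open>Changing the length of a window by a bounded amount does not change the limit of the averages.\<close>

lemma perturbed_average_tendsto:
  fixes S :: "nat \<Rightarrow> real" and m :: "nat \<Rightarrow> nat"
  assumes S: "(\<lambda>n. S n / real (2 * n)) \<longlonglongrightarrow> c"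
    and m: "\<And>n. n \<le> m n + q" "\<And>n. m n \<le> n + q"
  shows "(\<lambda>n. S (m n) / real (2 * n)) \<longlonglongrightarrow> c"
proof -
  have q: "(\<lambda>n. real q / real n) \<longlonglongrightarrow> 0" by (rule lim_const_over_n)
  have "(\<lambda>n. real (m n) / real n) \<longlonglongrightarrow> 1"
  proof (rule tendsto_sandwich)
    show "(\<lambda>n. 1 - real q / real n) \<longlonglongrightarrow> 1" "(\<lambda>n. 1 + real q / real n) \<longlonglongrightarrow> 1"
      using tendsto_diff[OF tendsto_const q, of 1] tendsto_add[OF tendsto_const q, of 1] by simp_all
    show "\<forall>\<^sub>F n in sequentially. 1 - real q / real n \<le> real (m n) / real n"
      using eventually_gt_at_top[of 0]
    proof eventually_elim
      case (elim n)
      have "real n \<le> real (m n) + real q" using m(1)[of n] by linarith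
      from divide_right_mono[OF this, of "real n"] show ?case
        using elim by (simp add: add_divide_distrib)
    qed
    show "\<forall>\<^sub>F n in sequentially. real (m n) / real n \<le> 1 + real q / real n"
      using eventually_gt_at_top[of 0]
    proof eventually_elim
      case (elim n)
      have "real (m n) \<le> real n + real q" using m(2)[of n] by linarith
      from divide_right_mono[OF this, of "real n"] show ?case
        using elim by (simp add: add_divide_distrib)
    qed
  qed
  moreover have "filterlim m at_top sequentially"
    unfolding filterlim_at_top
  proof
    fix Z
    show "\<forall>\<^sub>F n in sequentially. Z \<le> m n"
      using eventually_ge_at_top[of "Z + q"]
      by eventually_elim (use m(1) in \<open>metis add_le_cancel_right le_trans\<close>)
  qed
  then have "(\<lambda>n. S (m n) / real (2 * m n)) \<longlonglongrightarrow> c"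
    by (rule filterlim_compose[OF S])
  ultimately have "(\<lambda>n. S (m n) / real (2 * m n) * (real (m n) / real n)) \<longlonglongrightarrow> c * 1"
    by (intro tendsto_mult)
  moreover have "\<forall>\<^sub>F n in sequentially.
      S (m n) / real (2 * m n) * (real (m n) / real n) = S (m n) / real (2 * n)"
    using eventually_gt_at_top[of q]
  proof eventually_elim
    case (elim n)
    then have "m n > 0" using m(1)[of n] by linarith
    then show ?case by simp
  qed
  ultimately show ?thesis
    by (simp add: filterlim_cong)
qed

text \<open>The window \<open>[-n, n)\<close> is compared with the windows \<open>[j - k L, j + k L)\<close>, \<open>0 \<le> j < L\<close>, where \<open>k L\<close>
differs from \<open>n\<close> by at most \<open>2 L\<close>: they are contained in it for the upper bound and contain it for
the lower bound. Averaged over \<open>j\<close>, their values are \<open>1 / L\<close> times the sum of \<open>F i (i + L)\<close>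
over \<open>[-k L, k L)\<close>, minus the block defect. Dropping the nonnegative defect gives the upper bound;
a defect of at most \<open>L\<^sup>2 \<theta>\<close> per block costs \<open>\<theta>\<close> in the lower bound, one factor \<open>L\<close> being
used up by the average over \<open>j\<close> and the other by the length of a block.\<close>

lemma symmetric_growth_bounds:
  assumes F: "interval_subadditive F" and L: "L \<ge> 1"
    and e: "(\<lambda>n. (\<Sum>i\<in>{-int n..<int n}. \<bar>F i (i + 1)\<bar>) / real (2 * n)) \<longlonglongrightarrow> d"
    and G: "(\<lambda>n. (\<Sum>i\<in>{-int n..<int n}. F i (i + int L)) / real (2 * n)) \<longlonglongrightarrow> c"
  shows symmetric_growth_upper:
      "\<forall>u > c / real L. \<forall>\<^sub>F n in sequentially. F (-int n) (int n) / real (2 * n) < u"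
    and symmetric_growth_lower:
      "(\<And>k. k \<ge> 1 \<Longrightarrow> block_defect F L (-int k) (int k) \<le> 2 * real k * ((real L)\<^sup>2 * \<theta>)) \<Longrightarrow>
       \<forall>l < c / real L - \<theta>. \<forall>\<^sub>F n in sequentially. l < F (-int n) (int n) / real (2 * n)"
proof -
  define E where "E n = (\<Sum>i\<in>{-int n..<int n}. \<bar>F i (i + 1)\<bar>)" for n :: nat
  define H where "H n = (\<Sum>i\<in>{-int n..<int n}. F i (i + int L))" for n :: nat
  have E: "(\<lambda>n. E n / real (2 * n)) \<longlonglongrightarrow> d" using e by (simp add: E_def)
  have H: "(\<lambda>n. H n / real (2 * n)) \<longlonglongrightarrow> c" using G by (simp add: H_def)
  have div: "int (n div L) * int L \<le> int n" "int n < int (n div L) * int L + int L" for n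
    using L div_times_less_eq_dividend[of n L] dividend_less_div_times[of L n]
    by (simp_all flip: of_nat_mult of_nat_add)
  have average: "(\<Sum>j\<in>{0..<int L}. F (j - int k * int L) (j + int k * int L))
      = H (k * L) - block_defect F L (-int k) (int k)" for k
    by (simp add: block_defect_def H_def)
  show "\<forall>u > c / real L. \<forall>\<^sub>F n in sequentially. F (-int n) (int n) / real (2 * n) < u"
  proof (intro allI impI)
    fix u assume u: "c / real L < u"
    have lim: "(\<lambda>n. H ((n div L - 1) * L) / real (2 * n) / real L
        + (E n / real (2 * n) - E (n - 3 * L) / real (2 * n))) \<longlonglongrightarrow> c / real L + (d - d)"
    proof (intro tendsto_add tendsto_diff tendsto_divide tendsto_const E)
      show "(\<lambda>n. H ((n div L - 1) * L) / real (2 * n)) \<longlonglongrightarrow> c"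
      proof (rule perturbed_average_tendsto[OF H, of _ "2 * L"])
        fix n
        show "n \<le> (n div L - 1) * L + 2 * L" "(n div L - 1) * L \<le> n + 2 * L"
          using div[of n] by (cases "n div L"; simp add: algebra_simps flip: of_nat_mult of_nat_add)+
      qed
      show "(\<lambda>n. E (n - 3 * L) / real (2 * n)) \<longlonglongrightarrow> d"
        by (rule perturbed_average_tendsto[OF E, of _ "3 * L"]) auto
    qed (use L in auto)
    have "\<forall>\<^sub>F n in sequentially. H ((n div L - 1) * L) / real (2 * n) / real L
        + (E n / real (2 * n) - E (n - 3 * L) / real (2 * n)) < u"
      using order_tendstoD(2)[OF lim] u by simp
    with eventually_ge_at_top[of "3 * L"]
    show "\<forall>\<^sub>F n in sequentially. F (-int n) (int n) / real (2 * n) < u"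
    proof eventually_elim
      case (elim n)
      \<comment> \<open>Here \<open>n - 2 L < k L \<le> n - L\<close>, so all the shifted windows \<open>[j - k L, j + k L)\<close> lie in
        \<open>[-n, n)\<close> and contain \<open>[-(n - 3 L), n - 3 L)\<close>.\<close>
      define k where "k = n div L - 1"
      have "3 \<le> n div L" using elim(1) L by (simp add: less_eq_div_iff_mult_less_eq)
      then have k: "int (n div L) = int k + 1" by (simp add: k_def)
      have kL: "int k * int L + int L \<le> int n" "int n < int k * int L + 2 * int L"
        using div[of n] unfolding k by (simp_all add: algebra_simps)
      have "real L * F (-int n) (int n) = (\<Sum>j\<in>{0..<int L}. F (-int n) (int n))" by simp
      also have "\<dots> \<le> (\<Sum>j\<in>{0..<int L}. F (j - int k * int L) (j + int k * int L)
          + (E n - E (n - 3 * L)))"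
      proof (rule sum_mono)
        fix j assume j: "j \<in> {0..<int L}"
        have "int (n - 3 * L) = int n - 3 * int L" using elim(1) by simp
        then show "F (-int n) (int n) \<le> F (j - int k * int L) (j + int k * int L)
          + (E n - E (n - 3 * L))"
          unfolding E_def using j kL elim(1)
          by (intro interval_subadditive_nested[OF F]) auto
      qed
      also have "\<dots> = H (k * L) - block_defect F L (-int k) (int k)
          + real L * (E n - E (n - 3 * L))"
        by (simp add: sum.distrib average)
      also have "\<dots> \<le> H (k * L) + real L * (E n - E (n - 3 * L))"
        using block_defect_nonneg[OF F, of "-int k" "int k" L] by simp
      finally have "F (-int n) (int n) / real (2 * n) \<le> H (k * L) / real (2 * n) / real L
          + (E n / real (2 * n) - E (n - 3 * L) / real (2 * n))"
        using L elim(1) by (simp add: field_simps)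
      then show ?case using elim(2) unfolding k_def by linarith
    qed
  qed
  assume defect: "\<And>k. k \<ge> 1 \<Longrightarrow> block_defect F L (-int k) (int k) \<le> 2 * real k * ((real L)\<^sup>2 * \<theta>)"
  show "\<forall>l < c / real L - \<theta>. \<forall>\<^sub>F n in sequentially. l < F (-int n) (int n) / real (2 * n)"
  proof (intro allI impI)
    fix l assume l: "l < c / real L - \<theta>"
    define m where "m n = (n div L + 2) * L" for n
    have m: "n \<le> m n + 2 * L" "m n \<le> n + 2 * L" for n
      using div[of n] by (simp_all add: m_def algebra_simps flip: of_nat_mult of_nat_add)
    have two: "(\<lambda>n. 2 * real n / real (2 * n)) \<longlonglongrightarrow> 1"
      by (rule tendsto_eventually) (use eventually_gt_at_top[of 0] in eventually_elim, simp)
    have lim: "(\<lambda>n. H (m n) / real (2 * n) / real L - 2 * real (m n) / real (2 * n) * \<theta>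
        - (E (n + 3 * L) / real (2 * n) - E n / real (2 * n)))
        \<longlonglongrightarrow> c / real L - 1 * \<theta> - (d - d)"
    proof (intro tendsto_diff tendsto_divide tendsto_mult tendsto_const E)
      show "(\<lambda>n. H (m n) / real (2 * n)) \<longlonglongrightarrow> c"
        by (rule perturbed_average_tendsto[OF H m])
      show "(\<lambda>n. 2 * real (m n) / real (2 * n)) \<longlonglongrightarrow> 1"
        by (rule perturbed_average_tendsto[OF two m])
      show "(\<lambda>n. E (n + 3 * L) / real (2 * n)) \<longlonglongrightarrow> d"
        by (rule perturbed_average_tendsto[OF E, of _ "3 * L"]) auto
    qed (use L in auto)
    have "\<forall>\<^sub>F n in sequentially. l < H (m n) / real (2 * n) / real L
        - 2 * real (m n) / real (2 * n) * \<theta> - (E (n + 3 * L) / real (2 * n) - E n / real (2 * n))"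
      using order_tendstoD(1)[OF lim] l by simp
    with eventually_gt_at_top[of 0]
    show "\<forall>\<^sub>F n in sequentially. l < F (-int n) (int n) / real (2 * n)"
    proof eventually_elim
      case (elim n)
      \<comment> \<open>Here \<open>n + L < k L \<le> n + 2 L\<close>, so all the shifted windows contain \<open>[-n, n)\<close> and lie in
        \<open>[-(n + 3 L), n + 3 L)\<close>.\<close>
      define k where "k = n div L + 2"
      have k: "int (n div L) = int k - 2" "k \<ge> 1" by (simp_all add: k_def)
      have kL: "int k * int L \<le> int n + 2 * int L" "int n + int L < int k * int L"
        using div[of n] unfolding k by (simp_all add: algebra_simps)
      have "H (k * L) - 2 * real k * ((real L)\<^sup>2 * \<theta>) \<le> H (k * L) - block_defect F L (-int k) (int k)"
        using defect[OF k(2)] by simp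
      also have "\<dots> = (\<Sum>j\<in>{0..<int L}. F (j - int k * int L) (j + int k * int L))"
        by (rule average[symmetric])
      also have "\<dots> \<le> (\<Sum>j\<in>{0..<int L}. F (-int n) (int n) + (E (n + 3 * L) - E n))"
        unfolding E_def using kL
        by (intro sum_mono interval_subadditive_nested[OF F]) auto
      finally have "H (k * L) - 2 * real k * ((real L)\<^sup>2 * \<theta>)
          \<le> real L * (F (-int n) (int n) + (E (n + 3 * L) - E n))"
        by simp
      then have *: "(H (k * L) - 2 * real k * ((real L)\<^sup>2 * \<theta>)) / (real (2 * n) * real L)
          \<le> real L * (F (-int n) (int n) + (E (n + 3 * L) - E n)) / (real (2 * n) * real L)"
        using elim(1) L by (intro divide_right_mono) auto
      have "H (m n) / real (2 * n) / real L
        - 2 * real (m n) / real (2 * n) * \<theta> - (E (n + 3 * L) / real (2 * n) - E n / real (2 * n))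
        \<le> F (-int n) (int n) / real (2 * n)"
      proof -
        have "(h - 2 * k' * (l'\<^sup>2 * \<theta>)) / (2 * n' * l') = h / (2 * n') / l' - 2 * (k' * l') / (2 * n') * \<theta>"
          "l' * (h + (p - q)) / (2 * n' * l') = h / (2 * n') + (p / (2 * n') - q / (2 * n'))"
          if "n' > 0" "l' > 0" for h k' l' n' p q :: real
          using that by (simp_all add: field_simps power2_eq_square)
        from this(1)[of "real n" "real L" "H (k * L)" "real k"]
          this(2)[of "real n" "real L" "F (-int n) (int n)" "E (n + 3 * L)" "E n"]
        show ?thesis
          using *  elim(1) L unfolding m_def k_def[symmetric] by simp
      qed
      then show ?case using elim(2) by linarith
    qed
  qed
qed

text \<open>A covering argument of Vitali type. Take \<open>x\<close> in \<open>S\<close> with the largest radius \<open>k\<close>. The points of \<open>S\<close>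
at distance less than \<open>2 k\<close> from \<open>x\<close> are fewer than \<open>4 k\<close>, and they are paid for by the interval of
length \<open>2 k\<close> around \<open>x\<close>. The intervals of the remaining points, having radius at most \<open>k\<close>, lie
entirely to the left or entirely to the right of it, and induction applies to each side.\<close>

lemma superadditive_covering:
  fixes D :: "int \<Rightarrow> int \<Rightarrow> real" and r :: "int \<Rightarrow> nat"
  assumes nonneg: "\<And>a b. a \<le> b \<Longrightarrow> 0 \<le> D a b"
    and super: "\<And>a b c. a \<le> b \<Longrightarrow> b \<le> c \<Longrightarrow> D a b + D b c \<le> D a c"
    and "0 \<le> \<theta>" and "finite S"
    and large: "\<And>x. x \<in> S \<Longrightarrow> 2 * real (r x) * \<theta> \<le> D (x - int (r x)) (x + int (r x))"
    and "a \<le> b"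
    and "\<And>x. x \<in> S \<Longrightarrow> r x \<ge> 1 \<and> a \<le> x - int (r x) \<and> x + int (r x) \<le> b"
  shows "\<theta> * real (card S) \<le> 2 * D a b"
  using \<open>finite S\<close> large assms(6,7)
proof (induction S arbitrary: a b rule: finite_psubset_induct)
  case (psubset S)
  show ?case
  proof (cases "S = {}")
    case True
    then show ?thesis using nonneg[OF \<open>a \<le> b\<close>] by simp
  next
    case False
    have "Max (r ` S) \<in> r ` S" using psubset.hyps(1) False by (intro Max_in) auto
    then obtain x where xS: "x \<in> S" and "Max (r ` S) = r x" by (rule imageE)
    then have "r y \<le> r x" if "y \<in> S" for y
      using Max_ge[of "r ` S" "r y"] that psubset.hyps(1) by simp
    note x = xS this
    define k where "k = int (r x)"
    have k: "k \<ge> 1" "a \<le> x - k" "x + k \<le> b"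
      using psubset.prems(3)[OF x(1)] by (auto simp: k_def)
    define Left Mid Right where "Left = {y\<in>S. y \<le> x - 2 * k}"
      and "Mid = {y\<in>S. x - 2 * k < y \<and> y < x + 2 * k}" and "Right = {y\<in>S. x + 2 * k \<le> y}"
    have "\<theta> * real (card Left) \<le> 2 * D a (x - k)"
    proof (rule psubset.IH)
      have "x \<notin> Left" "Left \<subseteq> S" using k by (auto simp: Left_def)
      then show "Left \<subset> S" using x(1) by blast
      show "r y \<ge> 1 \<and> a \<le> y - int (r y) \<and> y + int (r y) \<le> x - k" if "y \<in> Left" for y
        using that psubset.prems(3)[of y] x(2)[of y] by (auto simp: Left_def k_def)
    qed (use psubset.prems k in \<open>auto simp: Left_def\<close>)
    moreover have "\<theta> * real (card Right) \<le> 2 * D (x + k) b"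
    proof (rule psubset.IH)
      have "x \<notin> Right" "Right \<subseteq> S" using k by (auto simp: Right_def)
      then show "Right \<subset> S" using x(1) by blast
      show "r y \<ge> 1 \<and> x + k \<le> y - int (r y) \<and> y + int (r y) \<le> b" if "y \<in> Right" for y
        using that psubset.prems(3)[of y] x(2)[of y] by (auto simp: Right_def k_def)
    qed (use psubset.prems k in \<open>auto simp: Right_def\<close>)
    moreover have "\<theta> * real (card Mid) \<le> 2 * D (x - k) (x + k)"
    proof -
      have "card Mid \<le> card {x - 2 * k<..<x + 2 * k}"
        by (rule card_mono) (auto simp: Mid_def)
      also have "\<dots> \<le> 4 * r x" by (simp add: k_def)
      finally have "\<theta> * real (card Mid) \<le> \<theta> * real (4 * r x)"
        using \<open>0 \<le> \<theta>\<close> by (intro mult_left_mono) auto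
      also have "\<dots> = 2 * (2 * real (r x) * \<theta>)" by simp
      also have "\<dots> \<le> 2 * D (x - k) (x + k)"
        unfolding k_def by (intro mult_left_mono psubset.prems(1)[OF x(1)]) simp
      finally show ?thesis .
    qed
    moreover have "D a (x - k) + D (x - k) (x + k) + D (x + k) b \<le> D a b"
      using super[of a "x - k" "x + k"] super[of a "x + k" b] k by linarith
    moreover have "real (card S) = real (card Left) + real (card Mid) + real (card Right)"
    proof -
      have "S = Left \<union> Mid \<union> Right" by (auto simp: Left_def Mid_def Right_def)
      moreover have "finite Left" "finite Mid" "finite Right"
        using psubset.hyps(1) by (auto simp: Left_def Mid_def Right_def)
      moreover have "Left \<inter> Mid = {}" "(Left \<union> Mid) \<inter> Right = {}"
        using k by (auto simp: Left_def Mid_def Right_def)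
      ultimately have "card S = card Left + card Mid + card Right"
        by (simp add: card_Un_disjoint)
      then show ?thesis by simp
    qed
    ultimately show ?thesis by (simp add: algebra_simps)
  qed
qed

section \<open>Actions of the integers\<close>

locale measure_preserving_Z_action = prob_space M for M :: "'a measure" +
  fixes act :: "int \<Rightarrow> 'a \<Rightarrow> 'a"
  assumes measure_preserving_act: "measure_preserving M (act k)"
    and act_0: "x \<in> space M \<Longrightarrow> act 0 x = x"
    and act_add: "x \<in> space M \<Longrightarrow> act (a + b) x = act a (act b x)"
begin

lemma act_measurable [measurable]: "act k \<in> measurable M M"
  by (rule measure_preserving_measurable[OF measure_preserving_act])

lemma act_space: "x \<in> space M \<Longrightarrow> act k x \<in> space M"
  by (rule measurable_space[OF act_measurable])

lemma dilated_action: "measure_preserving_Z_action M (\<lambda>k. act (k * d))"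
  by unfold_locales
     (simp_all add: measure_preserving_act act_0 act_add[symmetric] distrib_right)

lemma funpow_act: "x \<in> space M \<Longrightarrow> (act k ^^ n) x = act (int n * k) x"
proof (induction n)
  case (Suc n)
  then have "(act k ^^ Suc n) x = act (k + int n * k) x" by (simp add: act_add)
  then show ?case by (simp add: algebra_simps)
qed (simp add: act_0)

lemma ergodic_inverse:
  assumes "ergodic M (act 1)"
  shows "ergodic M (act (-1))"
  unfolding ergodic_def
proof (intro conjI ballI impI measure_preserving_act)
  fix A assume A: "A \<in> sets M" and inv: "act (-1) -` A \<inter> space M = A"
  have "act 1 x \<in> A \<longleftrightarrow> x \<in> A" if x: "x \<in> space M" for x
  proof -
    have "act 1 x \<in> A \<longleftrightarrow> act (-1) (act 1 x) \<in> A"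
      using inv act_space[OF x, of 1] by blast
    then show ?thesis using x by (simp add: act_add[symmetric] act_0)
  qed
  then have "act 1 -` A \<inter> space M = A" using sets.sets_into_space[OF A] by auto
  then show "prob A = 0 \<or> prob A = 1" using assms A by (simp add: ergodic_def)
qed

text \<open>A window splits at the origin into forward and backward halves, and the ergodic theorem applies to
the transformation and to its inverse.\<close>

theorem symmetric_birkhoff:
  fixes g :: "'a \<Rightarrow> real"
  assumes erg: "ergodic M (act 1)" and g: "integrable M g"
  shows "AE x in M. (\<lambda>n. (\<Sum>i\<in>{-int n..<int n}. g (act i x)) / real (2 * n)) \<longlonglongrightarrow> (\<integral>x. g x \<partial>M)"
proof -
  have h: "integrable M (\<lambda>x. g (act (-1) x))"
    by (rule measure_preserving_integrable[OF measure_preserving_act g])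
  have hint: "(\<integral>x. g (act (-1) x) \<partial>M) = (\<integral>x. g x \<partial>M)"
    using g by (intro measure_preserving_integral[OF measure_preserving_act]) auto
  show ?thesis
    using AE_space birkhoff[OF prob_space_axioms erg g]
      birkhoff[OF prob_space_axioms ergodic_inverse[OF erg] h, unfolded hint]
  proof eventually_elim
    case (elim x)
    let ?P = "\<lambda>n. \<Sum>i<n. g ((act 1 ^^ i) x)"
    let ?N = "\<lambda>n. \<Sum>i<n. g (act (-1) ((act (-1) ^^ i) x))"
    have split: "(\<Sum>i\<in>{-int n..<int n}. g (act i x)) = ?N n + ?P n" for n
    proof -
      have "?P n = (\<Sum>i\<in>{0..<int n}. g (act i x))"
        using elim(1)
        by (intro sum.reindex_bij_witness[of _ nat int]) (auto simp: funpow_act)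
      moreover have "?N n = (\<Sum>i\<in>{-int n..<0}. g (act i x))"
        using elim(1)
        by (intro sum.reindex_bij_witness[of _ "\<lambda>i. nat (- i - 1)" "\<lambda>i. - 1 - int i"])
           (auto simp: funpow_act act_add[symmetric])
      ultimately show ?thesis
        using sum_int_concat[of "-int n" 0 "int n" "\<lambda>i. g (act i x)"] by simp
    qed
    have "(\<lambda>n. (?N n / real n + ?P n / real n) / 2) \<longlonglongrightarrow> ((\<integral>x. g x \<partial>M) + (\<integral>x. g x \<partial>M)) / 2"
      using elim by (intro tendsto_divide tendsto_add) auto
    then show ?case by (simp add: split add_divide_distrib mult.commute)
  qed
qed

text \<open>A stationary superadditive process that grows slowly on average is rarely large on any symmetric
interval. The covering lemma, applied along an orbit segment of length \<open>n\<close>, bounds the number of times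
\<open>i\<close> at which some interval of radius at most \<open>K\<close> around \<open>i\<close> is too heavy by the value of the process
on the whole segment. Integration turns this number into \<open>n\<close> times the probability of the exceptional
set, up to the \<open>2 K\<close> times near the ends of the segment, which disappear as \<open>n\<close> tends to infinity.\<close>

theorem maximal_inequality:
  fixes \<Phi> :: "'a \<Rightarrow> int \<Rightarrow> int \<Rightarrow> real"
  assumes stationary: "\<And>x a b c. x \<in> space M \<Longrightarrow> \<Phi> (act c x) a b = \<Phi> x (a + c) (b + c)"
    and integ: "\<And>a b. integrable M (\<lambda>x. \<Phi> x a b)"
    and pos: "AE x in M. \<forall>a b. a \<le> b \<longrightarrow> 0 \<le> \<Phi> x a b"
    and super: "AE x in M. \<forall>a b c. a \<le> b \<longrightarrow> b \<le> c \<longrightarrow> \<Phi> x a b + \<Phi> x b c \<le> \<Phi> x a c"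
    and growth: "(\<lambda>n. (\<integral>x. \<Phi> x 0 (int n) \<partial>M) / real n) \<longlonglongrightarrow> \<gamma>"
    and "0 \<le> \<theta>"
  shows "\<theta> * prob {x \<in> space M. \<exists>k\<ge>1. 2 * real k * \<theta> < \<Phi> x (-int k) (int k)} \<le> 2 * \<gamma>"
proof -
  note borel_measurable_integrable[OF integ, measurable]
  define E where "E K = {x \<in> space M. \<exists>k\<in>{1..K}. 2 * real k * \<theta> < \<Phi> x (-int k) (int k)}" for K
  have E[measurable]: "E K \<in> sets M" for K unfolding E_def by measurable
  have bound: "\<theta> * prob (E K) \<le> 2 * \<gamma>" for K
  proof -
    have ineq: "(1 - (2 * real K - 1) / real n) * (\<theta> * prob (E K)) \<le> 2 * ((\<integral>x. \<Phi> x 0 (int n) \<partial>M) / real n)"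
      if n: "n > 2 * K" for n
    proof -
      \<comment> \<open>The times \<open>i\<close> for which every interval of radius at most \<open>K\<close> around \<open>i\<close> stays in \<open>[0, n)\<close>.\<close>
      define J where "J = {int K..int n - int K}"
      have ind: "integrable M (\<lambda>x. indicat_real (E K) (act i x))" for i
        by (rule measure_preserving_integrable[OF measure_preserving_act])
           (simp add: integrable_indicator_iff emeasure_eq_measure)
      have "AE x in M. \<theta> * (\<Sum>i\<in>J. indicat_real (E K) (act i x)) \<le> 2 * \<Phi> x 0 (int n)"
        using AE_space pos super
      proof eventually_elim
        case (elim x)
        define S where "S = {i\<in>J. act i x \<in> E K}"
        have "finite S" by (rule finite_subset[of _ J]) (auto simp: S_def J_def)
        have "\<exists>k\<in>{1..K}. 2 * real k * \<theta> < \<Phi> x (i - int k) (i + int k)" if "i \<in> S" for i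
          using that stationary[OF elim(1), of i] by (auto simp: S_def E_def algebra_simps)
        then obtain r where r: "\<And>i. i \<in> S \<Longrightarrow> r i \<in> {1..K}"
            "\<And>i. i \<in> S \<Longrightarrow> 2 * real (r i) * \<theta> < \<Phi> x (i - int (r i)) (i + int (r i))"
          by metis
        have "(\<Sum>i\<in>J. indicat_real (E K) (act i x)) = real (card S)"
        proof -
          have "(\<Sum>i\<in>J. indicat_real (E K) (act i x)) = (\<Sum>i\<in>S. 1)"
            by (rule sum.mono_neutral_cong_right) (auto simp: S_def J_def indicator_def)
          then show ?thesis by simp
        qed
        moreover have "\<theta> * real (card S) \<le> 2 * \<Phi> x 0 (int n)"
        proof (rule superadditive_covering[where r = r])
          show "r i \<ge> 1 \<and> 0 \<le> i - int (r i) \<and> i + int (r i) \<le> int n" if "i \<in> S" for i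
            using r(1)[OF that] that by (auto simp: S_def J_def)
          show "2 * real (r i) * \<theta> \<le> \<Phi> x (i - int (r i)) (i + int (r i))" if "i \<in> S" for i
            using r(2)[OF that] by simp
        qed (use elim \<open>0 \<le> \<theta>\<close> \<open>finite S\<close> in auto)
        ultimately show ?case by simp
      qed
      then have "(\<integral>x. \<theta> * (\<Sum>i\<in>J. indicat_real (E K) (act i x)) \<partial>M) \<le> (\<integral>x. 2 * \<Phi> x 0 (int n) \<partial>M)"
        by (intro integral_mono_AE integrable_mult_right Bochner_Integration.integrable_sum ind integ)
      moreover have "(\<integral>x. indicat_real (E K) (act i x) \<partial>M) = prob (E K)" for i
        by (subst measure_preserving_integral[OF measure_preserving_act]) auto
      ultimately have "\<theta> * (real (card J) * prob (E K)) \<le> 2 * (\<integral>x. \<Phi> x 0 (int n) \<partial>M)"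
        using ind by (simp add: Bochner_Integration.integral_sum)
      moreover have "real (card J) = real n - (2 * real K - 1)"
        using n by (simp add: J_def of_nat_diff)
      ultimately have bound_n: "(real n - (2 * real K - 1)) * (\<theta> * prob (E K)) / real n
          \<le> 2 * (\<integral>x. \<Phi> x 0 (int n) \<partial>M) / real n"
        by (intro divide_right_mono) (simp_all add: algebra_simps)
      have "1 - (2 * real K - 1) / real n = (real n - (2 * real K - 1)) / real n"
        using n by (simp add: diff_divide_distrib)
      then show ?thesis using bound_n by simp
    qed
    have "(\<lambda>n. (2 * real K - 1) / real n) \<longlonglongrightarrow> 0" by (rule lim_const_over_n)
    then have "(\<lambda>n. (1 - (2 * real K - 1) / real n) * (\<theta> * prob (E K))) \<longlonglongrightarrow> (1 - 0) * (\<theta> * prob (E K))"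
      by (intro tendsto_mult tendsto_diff tendsto_const)
    then have "(1 - 0) * (\<theta> * prob (E K)) \<le> 2 * \<gamma>"
    proof (rule LIMSEQ_le)
      show "(\<lambda>n. 2 * ((\<integral>x. \<Phi> x 0 (int n) \<partial>M) / real n)) \<longlonglongrightarrow> 2 * \<gamma>"
        by (intro tendsto_mult tendsto_const growth)
      show "\<exists>N. \<forall>n\<ge>N. (1 - (2 * real K - 1) / real n) * (\<theta> * prob (E K)) \<le> 2 * ((\<integral>x. \<Phi> x 0 (int n) \<partial>M) / real n)"
        using ineq by (intro exI[of _ "2 * K + 1"]) auto
    qed
    then show ?thesis by simp
  qed
  have "(\<lambda>K. prob (E K)) \<longlonglongrightarrow> prob (\<Union>K. E K)"
    by (rule finite_Lim_measure_incseq) (auto simp: incseq_def E_def)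
  then have "(\<lambda>K. \<theta> * prob (E K)) \<longlonglongrightarrow> \<theta> * prob (\<Union>K. E K)"
    by (intro tendsto_mult tendsto_const)
  then have "\<theta> * prob (\<Union>K. E K) \<le> 2 * \<gamma>"
    by (rule LIMSEQ_le_const2) (use bound in auto)
  moreover have "(\<Union>K. E K) = {x \<in> space M. \<exists>k\<ge>1. 2 * real k * \<theta> < \<Phi> x (-int k) (int k)}"
    (is "_ = ?R")
  proof (intro set_eqI iffI)
    fix x assume "x \<in> ?R"
    then obtain k where "x \<in> space M" "k \<ge> 1" "2 * real k * \<theta> < \<Phi> x (-int k) (int k)" by auto
    then have "x \<in> E k" by (auto simp: E_def)
    then show "x \<in> (\<Union>K. E K)" by blast
  qed (auto simp: E_def)
  ultimately show ?thesis by simp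
qed

end

section \<open>Symmetric averages of a subadditive sequence\<close>

locale ergodic_subadditive_sequence = measure_preserving_Z_action +
  fixes f :: "nat \<Rightarrow> 'a \<Rightarrow> real"
  assumes erg: "ergodic M (act 1)"
    and integrable_f: "n \<ge> 1 \<Longrightarrow> integrable M (f n)"
    and subadditive: "m \<ge> 1 \<Longrightarrow> n \<ge> 1 \<Longrightarrow> AE x in M. f (m + n) x \<le> f m (act (int n) x) + f n x"
begin

text \<open>The value of the sequence on the piece of the orbit of \<open>x\<close> from time \<open>a\<close> to time \<open>b\<close>. The empty
piece gets the value \<open>0\<close>, whatever \<open>f 0\<close> may be.\<close>

definition window :: "'a \<Rightarrow> int \<Rightarrow> int \<Rightarrow> real" where
  "window x a b = (if a < b then f (nat (b - a)) (act a x) else 0)"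

lemma window_act: "x \<in> space M \<Longrightarrow> window (act c x) a b = window x (a + c) (b + c)"
  by (simp add: window_def act_add)

lemma integrable_window: "integrable M (\<lambda>x. window x a b)"
proof (cases "a < b")
  case True
  then show ?thesis
    by (simp add: window_def measure_preserving_integrable[OF measure_preserving_act] integrable_f)
qed (simp add: window_def)

lemma integral_window:
  "a < b \<Longrightarrow> (\<integral>x. window x a b \<partial>M) = (\<integral>x. f (nat (b - a)) x \<partial>M)"
  unfolding window_def using integrable_f[of "nat (b - a)"]
  by (auto intro!: measure_preserving_integral[OF measure_preserving_act])

lemma AE_interval_subadditive: "AE x in M. interval_subadditive (window x)"
proof -
  have "AE x in M. window x a c \<le> window x a b + window x b c" if "a \<le> b" "b \<le> c" for a b c
  proof (cases "a < b \<and> b < c")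
    case True
    have "AE x in M. f (nat (c - b) + nat (b - a)) x \<le> f (nat (c - b)) (act (int (nat (b - a))) x) + f (nat (b - a)) x"
      using True by (intro subadditive) auto
    from measure_preserving_AE[OF measure_preserving_act this, of a] AE_space
    show ?thesis
    proof eventually_elim
      case (elim x)
      have "act (int (nat (b - a))) (act a x) = act b x"
        using True elim(2) by (simp add: act_add[symmetric])
      moreover have "nat (c - b) + nat (b - a) = nat (c - a)"
        using True by (simp flip: nat_add_distrib)
      ultimately show ?case using elim(1) True by (simp add: window_def)
    qed
  next
    case False
    then have "a = b \<or> b = c" using that by auto
    then show ?thesis by (auto simp: window_def)
  qed
  then have "AE x in M. \<forall>a b c. a \<le> b \<longrightarrow> b \<le> c \<longrightarrow> window x a c \<le> window x a b + window x b c"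
    by (simp add: AE_all_countable)
  then show ?thesis
    by eventually_elim (simp add: interval_subadditive_def window_def)
qed

definition mean :: "nat \<Rightarrow> real" where "mean n = (\<integral>x. f n x \<partial>M)"

definition growth_rate :: ereal where
  "growth_rate = (INF n\<in>{1..}. ereal (mean n / real n))"

lemma mean_subadditive:
  assumes "m \<ge> 1" "n \<ge> 1"
  shows "mean (m + n) \<le> mean m + mean n"
proof -
  have m: "integrable M (\<lambda>x. f m (act (int n) x))"
    by (intro measure_preserving_integrable[OF measure_preserving_act] integrable_f assms)
  have "mean (m + n) \<le> (\<integral>x. f m (act (int n) x) + f n x \<partial>M)"
    unfolding mean_def using assms
    by (intro integral_mono_AE Bochner_Integration.integrable_add m subadditive integrable_f) auto
  also have "\<dots> = (\<integral>x. f m (act (int n) x) \<partial>M) + mean n"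
    unfolding mean_def using assms by (intro Bochner_Integration.integral_add m integrable_f)
  also have "(\<integral>x. f m (act (int n) x) \<partial>M) = mean m"
    unfolding mean_def using integrable_f[OF assms(1)]
    by (intro measure_preserving_integral[OF measure_preserving_act]) auto
  finally show ?thesis .
qed

lemma integral_growth: "(\<lambda>n. ereal (mean n / real n)) \<longlonglongrightarrow> growth_rate"
  unfolding growth_rate_def by (rule fekete) (rule mean_subadditive)

lemma AE_block_averages:
  assumes "L \<ge> 1"
  shows "AE x in M. (\<lambda>n. (\<Sum>i\<in>{-int n..<int n}. window x i (i + int L)) / real (2 * n)) \<longlonglongrightarrow> mean L"
  using symmetric_birkhoff[OF erg integrable_f[OF assms]] assms by (simp add: window_def mean_def)

lemma AE_abs_averages:
  "AE x in M. (\<lambda>n. (\<Sum>i\<in>{-int n..<int n}. \<bar>window x i (i + 1)\<bar>) / real (2 * n)) \<longlonglongrightarrow> (\<integral>x. \<bar>f 1 x\<bar> \<partial>M)"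
  using symmetric_birkhoff[OF erg, of "\<lambda>x. \<bar>f 1 x\<bar>"] integrable_f[of 1] by (simp add: window_def)

lemma AE_upper:
  "AE x in M. \<forall>u. growth_rate < ereal u \<longrightarrow>
     (\<forall>\<^sub>F n in sequentially. window x (-int n) (int n) / real (2 * n) < u)"
proof -
  have "AE x in M. \<forall>L\<in>{1..}. \<forall>u > mean L / real L.
      \<forall>\<^sub>F n in sequentially. window x (-int n) (int n) / real (2 * n) < u"
  proof (subst AE_ball_countable)
    show "\<forall>L\<in>{1..}. AE x in M. \<forall>u > mean L / real L.
      \<forall>\<^sub>F n in sequentially. window x (-int n) (int n) / real (2 * n) < u"
    proof
      fix L :: nat assume "L \<in> {1..}"
      then have L: "L \<ge> 1" by simp
      from AE_interval_subadditive AE_abs_averages AE_block_averages[OF L]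
      show "AE x in M. \<forall>u > mean L / real L.
        \<forall>\<^sub>F n in sequentially. window x (-int n) (int n) / real (2 * n) < u"
        by eventually_elim (rule symmetric_growth_upper[OF _ L])
    qed
  qed auto
  then show ?thesis
  proof eventually_elim
    case (elim x)
    show ?case
    proof (intro allI impI)
      fix u assume "growth_rate < ereal u"
      then obtain L :: nat where "L \<in> {1..}" "mean L / real L < u"
        by (auto simp: growth_rate_def INF_less_iff)
      then show "\<forall>\<^sub>F n in sequentially. window x (-int n) (int n) / real (2 * n) < u"
        using elim by blast
    qed
  qed
qed

definition defect_exceeds :: "real \<Rightarrow> nat \<Rightarrow> 'a set" where
  "defect_exceeds \<theta> L =
     {x \<in> space M. \<exists>k\<ge>1. 2 * real k * ((real L)\<^sup>2 * \<theta>) < block_defect (window x) L (-int k) (int k)}"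

lemma integrable_block_defect: "integrable M (\<lambda>x. block_defect (window x) L a b)"
  unfolding block_defect_def
  by (intro Bochner_Integration.integrable_diff Bochner_Integration.integrable_sum integrable_window)

lemma sets_defect_exceeds: "defect_exceeds \<theta> L \<in> sets M"
proof -
  note borel_measurable_integrable[OF integrable_block_defect, measurable]
  show ?thesis unfolding defect_exceeds_def by measurable
qed

lemma integral_block_defect:
  assumes "L \<ge> 1" "n \<ge> 1"
  shows "(\<integral>x. block_defect (window x) L 0 (int n) \<partial>M) = real L * (real n * mean L - mean (n * L))"
proof -
  have "(\<integral>x. window x i (i + int L) \<partial>M) = mean L" for i
    using integral_window[of i "i + int L"] assms by (simp add: mean_def)
  moreover have "(\<integral>x. window x j (j + int n * int L) \<partial>M) = mean (n * L)" for j
    using integral_window[of j "j + int n * int L"] assms by (simp add: mean_def nat_mult_distrib)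
  ultimately show ?thesis
    by (simp add: block_defect_def Bochner_Integration.integral_diff
        Bochner_Integration.integral_sum integrable_window Bochner_Integration.integrable_sum algebra_simps nat_mult_distrib)
qed

text \<open>The mean of the block defect has growth rate \<open>L (mean L - L c)\<close> per block, and the threshold in the
exceptional set is \<open>L\<^sup>2 \<theta>\<close>. The maximal inequality is applied to the \<open>L\<close>-th power of the
transformation, along whose orbits the block defect is stationary.\<close>

lemma prob_defect_exceeds_le:
  assumes c: "growth_rate = ereal c" and L: "L \<ge> 1" and \<theta>: "\<theta> > 0"
  shows "prob (defect_exceeds \<theta> L) \<le> 2 / \<theta> * (mean L / real L - c)"
proof -
  have avg: "(\<lambda>n. mean n / real n) \<longlonglongrightarrow> c"
    using integral_growth unfolding c by simp
  have "(\<lambda>n. (\<integral>x. block_defect (window x) L 0 (int n) \<partial>M) / real n) \<longlonglongrightarrow> real L * (mean L - real L * c)"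
  proof (rule Lim_transform_eventually)
    have "filterlim (\<lambda>n. n * L) at_top sequentially"
      by (rule filterlim_at_top_mono[OF filterlim_ident]) (use L in \<open>auto intro: eventuallyI\<close>)
    from filterlim_compose[OF avg this]
    show "(\<lambda>n. real L * (mean L - real L * (mean (n * L) / real (n * L)))) \<longlonglongrightarrow> real L * (mean L - real L * c)"
      by (intro tendsto_mult tendsto_diff tendsto_const)
    show "\<forall>\<^sub>F n in sequentially. real L * (mean L - real L * (mean (n * L) / real (n * L)))
        = (\<integral>x. block_defect (window x) L 0 (int n) \<partial>M) / real n"
      using eventually_ge_at_top[of 1]
      by eventually_elim (use L in \<open>simp add: integral_block_defect field_simps\<close>)
  qed
  then have "(real L)\<^sup>2 * \<theta> * prob (defect_exceeds \<theta> L) \<le> 2 * (real L * (mean L - real L * c))"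
    unfolding defect_exceeds_def
  proof (intro measure_preserving_Z_action.maximal_inequality[OF dilated_action[of "int L"]])
    fix x a b d assume x: "x \<in> space M"
    have "(\<Sum>i\<in>{a * int L..<b * int L}. window x (i + d * int L) (i + int L + d * int L))
        = (\<Sum>i\<in>{(a + d) * int L..<(b + d) * int L}. window x i (i + int L))"
      by (rule sum.reindex_bij_witness[of _ "\<lambda>i. i - d * int L" "\<lambda>i. i + d * int L"])
         (auto simp: algebra_simps)
    then show "block_defect (window (act (d * int L) x)) L a b = block_defect (window x) L (a + d) (b + d)"
      using x by (simp add: block_defect_def window_act algebra_simps)
  next
    show "AE x in M. \<forall>a b. a \<le> b \<longrightarrow> 0 \<le> block_defect (window x) L a b"
      using AE_interval_subadditive by eventually_elim (blast intro: block_defect_nonneg)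
    show "AE x in M. \<forall>a b c. a \<le> b \<longrightarrow> b \<le> c \<longrightarrow>
        block_defect (window x) L a b + block_defect (window x) L b c \<le> block_defect (window x) L a c"
      using AE_interval_subadditive by eventually_elim (blast intro: block_defect_superadditive)
  qed (use \<theta> integrable_block_defect in auto)
  also have "2 * (real L * (mean L - real L * c)) = (real L)\<^sup>2 * (2 * (mean L / real L - c))"
    using L by (simp add: field_simps power2_eq_square)
  finally have "\<theta> * prob (defect_exceeds \<theta> L) \<le> 2 * (mean L / real L - c)"
    using L by (simp add: mult.assoc)
  then show ?thesis using \<theta> by (simp add: field_simps)
qed

text \<open>\<open>mean L / L\<close> tends to \<open>c\<close>, so the probabilities of the exceptional sets tend to \<open>0\<close>.\<close>

lemma AE_some_block_defect_small:
  assumes c: "growth_rate = ereal c" and \<theta>: "\<theta> > 0"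
  shows "AE x in M. \<exists>L\<ge>1. x \<notin> defect_exceeds \<theta> L"
proof -
  define B where "B = (\<Inter>L\<in>{1..}. defect_exceeds \<theta> L)"
  have B: "B \<in> sets M" unfolding B_def by (intro sets.countable_INT') (auto intro: sets_defect_exceeds)
  have avg: "(\<lambda>n. mean n / real n) \<longlonglongrightarrow> c"
    using integral_growth unfolding c by simp
  have "(\<lambda>L. 2 / \<theta> * (mean L / real L - c)) \<longlonglongrightarrow> 2 / \<theta> * (c - c)"
    by (intro tendsto_mult tendsto_diff tendsto_const avg)
  moreover have "prob B \<le> 2 / \<theta> * (mean L / real L - c)" if "L \<ge> 1" for L
  proof -
    have "prob B \<le> prob (defect_exceeds \<theta> L)"
      using that by (intro finite_measure_mono sets_defect_exceeds) (auto simp: B_def)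
    then show ?thesis using prob_defect_exceeds_le[OF c that \<theta>] by linarith
  qed
  ultimately have "prob B \<le> 2 / \<theta> * (c - c)"
    by (intro LIMSEQ_le_const) auto
  then have "prob B = 0" by (simp add: measure_le_0_iff)
  then have "AE x in M. x \<notin> B"
    using B by (intro AE_not_in) (simp add: null_sets_def emeasure_eq_measure)
  then show ?thesis by eventually_elim (auto simp: B_def)
qed

lemma AE_lower:
  assumes c: "growth_rate = ereal c"
  shows "AE x in M. \<forall>l<c. \<forall>\<^sub>F n in sequentially. l < window x (-int n) (int n) / real (2 * n)"
proof -
  have "AE x in M. \<forall>p::nat. \<exists>L\<ge>1. x \<notin> defect_exceeds (1 / real (Suc p)) L"
    unfolding AE_all_countable by (intro allI AE_some_block_defect_small[OF c]) simp
  moreover have "AE x in M. \<forall>L\<in>{1..}. (\<lambda>n. (\<Sum>i\<in>{-int n..<int n}. window x i (i + int L)) / real (2 * n)) \<longlonglongrightarrow> mean L"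
  proof (subst AE_ball_countable)
    show "\<forall>L\<in>{1..}. AE x in M. (\<lambda>n. (\<Sum>i\<in>{-int n..<int n}. window x i (i + int L)) / real (2 * n)) \<longlonglongrightarrow> mean L"
    proof
      fix L :: nat assume "L \<in> {1..}"
      then show "AE x in M. (\<lambda>n. (\<Sum>i\<in>{-int n..<int n}. window x i (i + int L)) / real (2 * n)) \<longlonglongrightarrow> mean L"
        by (intro AE_block_averages) simp
    qed
  qed auto
  ultimately show ?thesis
    using AE_space AE_interval_subadditive AE_abs_averages
  proof eventually_elim
    case (elim x)
    show ?case
    proof (intro allI impI)
      fix l assume "l < c"
      then obtain p :: nat where p: "1 / real (Suc p) < c - l"
        using nat_approx_posE[of "c - l"] by auto
      obtain L where L: "L \<ge> 1" "x \<notin> defect_exceeds (1 / real (Suc p)) L"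
        using elim(1) by blast
      have "ereal c \<le> ereal (mean L / real L)"
        unfolding c[symmetric] growth_rate_def using L(1) by (intro INF_lower) auto
      then have l: "l < mean L / real L - 1 / real (Suc p)" using p by simp
      have defect: "block_defect (window x) L (-int k) (int k) \<le> 2 * real k * ((real L)\<^sup>2 * (1 / real (Suc p)))"
        if "k \<ge> 1" for k
        using L(2) elim(3) that unfolding defect_exceeds_def by (auto simp: not_less)
      have "(\<lambda>n. (\<Sum>i\<in>{-int n..<int n}. window x i (i + int L)) / real (2 * n)) \<longlonglongrightarrow> mean L"
        using elim(2) L(1) by simp
      from symmetric_growth_lower[OF elim(4) L(1) elim(5) this defect] l
      show "\<forall>\<^sub>F n in sequentially. l < window x (-int n) (int n) / real (2 * n)"
        by blast
    qed
  qed
qed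

theorem AE_symmetric_growth:
  "AE x in M. (\<lambda>n. ereal (window x (-int n) (int n) / real (2 * n))) \<longlonglongrightarrow> growth_rate"
proof -
  have "AE x in M. \<forall>l. ereal l < growth_rate \<longrightarrow>
     (\<forall>\<^sub>F n in sequentially. l < window x (-int n) (int n) / real (2 * n))"
  proof (cases growth_rate)
    case (real c)
    show ?thesis using AE_lower[OF real] by (simp add: real)
  next
    case PInf
    have "growth_rate \<le> ereal (mean 1 / real 1)"
      unfolding growth_rate_def by (intro INF_lower) auto
    then show ?thesis using PInf by simp
  qed simp
  with AE_upper show ?thesis
  proof eventually_elim
    case (elim x)
    show ?case
    proof (rule order_tendstoI)
      fix a assume "a < growth_rate"
      then obtain l where l: "a < ereal l" "ereal l < growth_rate" using ereal_dense2 by blast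
      then have "\<forall>\<^sub>F n in sequentially. l < window x (-int n) (int n) / real (2 * n)"
        using elim(2) by blast
      then show "\<forall>\<^sub>F n in sequentially. a < ereal (window x (-int n) (int n) / real (2 * n))"
        by eventually_elim (rule less_trans[OF l(1)], simp)
    next
      fix a assume "growth_rate < a"
      then obtain u where u: "growth_rate < ereal u" "ereal u < a" using ereal_dense2 by blast
      then have "\<forall>\<^sub>F n in sequentially. window x (-int n) (int n) / real (2 * n) < u"
        using elim(1) by blast
      then show "\<forall>\<^sub>F n in sequentially. ereal (window x (-int n) (int n) / real (2 * n)) < a"
        by eventually_elim (rule less_trans[OF _ u(2)], simp)
    qed
  qed
qed

end

section \<open>Iterates of an invertible transformation\<close>

text \<open>Negative exponents iterate the inverse on \<open>space M\<close>; outside of \<open>space M\<close> this inverse is arbitrary,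
so the group law holds only on \<open>space M\<close>.\<close>

definition int_iterate :: "'a measure \<Rightarrow> ('a \<Rightarrow> 'a) \<Rightarrow> int \<Rightarrow> 'a \<Rightarrow> 'a" where
  "int_iterate M T k = (if 0 \<le> k then T ^^ nat k else inv_into (space M) T ^^ nat (- k))"

lemma measure_preserving_funpow:
  assumes "measure_preserving M T"
  shows "measure_preserving M (T ^^ n)"
proof (induction n)
  case 0
  have "distr M M id = M" unfolding id_def by (rule distr_id)
  then show ?case by (simp add: measure_preserving_def)
next
  case (Suc n)
  note Tm = measure_preserving_measurable[OF assms] and nm = measure_preserving_measurable[OF Suc]
  have "distr M M (T \<circ> T ^^ n) = M"
    using distr_distr[OF Tm nm]
    unfolding measure_preserving_distr[OF Suc] measure_preserving_distr[OF assms] by (rule sym)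
  then show ?case unfolding measure_preserving_def
    using measurable_comp[OF nm Tm] by simp
qed

lemma measure_preserving_inverse:
  assumes T: "measure_preserving M T" and bij: "bij_betw T (space M) (space M)"
    and S: "inv_into (space M) T \<in> measurable M M"
  shows "measure_preserving M (inv_into (space M) T)"
proof -
  let ?S = "inv_into (space M) T"
  note Tm = measure_preserving_measurable[OF T]
  have "distr M M ?S = distr (distr M M T) M ?S"
    unfolding measure_preserving_distr[OF T] by (rule refl)
  also have "\<dots> = distr M M (?S \<circ> T)" by (rule distr_distr[OF S Tm])
  also have "\<dots> = distr M M (\<lambda>x. x)"
    using bij by (intro distr_cong) (auto simp: bij_betw_def)
  finally show ?thesis using S by (simp only: measure_preserving_def distr_id)
qed

lemma int_iterate_action:
  assumes "prob_space M" and inv: "invertible_measure_preserving M T"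
  shows "measure_preserving_Z_action M (int_iterate M T)"
proof -
  let ?S = "inv_into (space M) T" and ?act = "int_iterate M T"
  have T: "measure_preserving M T" and bij: "bij_betw T (space M) (space M)"
    and Sm: "?S \<in> measurable M M"
    using inv by (simp_all only: invertible_measure_preserving_def)
  have S: "measure_preserving M ?S" by (rule measure_preserving_inverse[OF T bij Sm])
  have act: "measure_preserving M (?act k)" for k
    unfolding int_iterate_def using measure_preserving_funpow[OF T] measure_preserving_funpow[OF S]
    by simp
  have space: "?act k x \<in> space M" if "x \<in> space M" for k x
    by (rule measurable_space[OF measure_preserving_measurable[OF act] that])
  have TS: "T (?S x) = x" and ST: "?S (T x) = x" if "x \<in> space M" for x
    using bij that by (auto simp: bij_betw_def f_inv_into_f)
  have up: "?act (k + 1) x = T (?act k x)" if x: "x \<in> space M" for k x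
  proof (cases "0 \<le> k")
    case True
    then show ?thesis by (simp add: int_iterate_def nat_add_distrib)
  next
    case False
    define m where "m = nat (- k - 1)"
    have k: "k = - int (Suc m)" using False by (simp add: m_def)
    have "(?S ^^ m) x \<in> space M"
      by (rule measurable_space[OF measure_preserving_measurable[OF measure_preserving_funpow[OF S]] x])
    moreover have neg: "?act (- int j) = ?S ^^ j" for j
      by (cases "j = 0") (auto simp: int_iterate_def)
    ultimately have "T (?act k x) = (?S ^^ m) x"
      unfolding k neg by (simp add: TS)
    moreover have "k + 1 = - int m" using k by simp
    then have "?act (k + 1) x = (?S ^^ m) x" by (simp only: neg)
    ultimately show ?thesis by simp
  qed
  have down: "?act (k - 1) x = ?S (?act k x)" if x: "x \<in> space M" for k x
    using up[OF x, of "k - 1"] ST[OF space[OF x, of "k - 1"]] by simp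
  show ?thesis
  proof (intro measure_preserving_Z_action.intro measure_preserving_Z_action_axioms.intro)
    show "?act (a + b) x = ?act a (?act b x)" if x: "x \<in> space M" for a b x
    proof (induction a rule: int_induct[where k = 0])
      case base
      then show ?case by (simp add: int_iterate_def)
    next
      case (step1 a)
      then show ?case
        using up[OF x, of "a + b"] up[OF space[OF x], of a b] by (simp add: algebra_simps)
    next
      case (step2 a)
      then show ?case
        using down[OF x, of "a + b"] down[OF space[OF x], of a b] by (simp add: algebra_simps)
    qed
  qed (use assms act in \<open>auto simp: int_iterate_def\<close>)
qed

theorem theorem23:
  fixes M :: "'a measure" and \<sigma> :: "'a \<Rightarrow> 'a" and f :: "nat \<Rightarrow> 'a \<Rightarrow> real"
  assumes "lebesgue_prob_space M"
    and "invertible_measure_preserving M \<sigma>"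
    and "ergodic M \<sigma>"
    and "\<And>n. n \<ge> 1 \<Longrightarrow> integrable M (f n)"
    and "subadditive_sequence M \<sigma> f"
  shows "\<exists>C::ereal. C < \<infinity> \<and>
           (\<lambda>n. ereal ((1 / real n) * (\<integral>\<omega>. f n \<omega> \<partial>M))) \<longlonglongrightarrow> C \<and>
           (AE \<omega> in M. (\<lambda>n. ereal ((1 / real (2 * n)) *
                f (2 * n) ((inv_into (space M) \<sigma> ^^ n) \<omega>))) \<longlonglongrightarrow> C)"
proof -
  have prob: "prob_space M" using assms(1) by (simp add: lebesgue_prob_space_def)
  interpret measure_preserving_Z_action M "int_iterate M \<sigma>"
    by (rule int_iterate_action[OF prob assms(2)])
  interpret ergodic_subadditive_sequence M "int_iterate M \<sigma>" f
  proof
    show "ergodic M (int_iterate M \<sigma> 1)" using assms(3) by (simp add: int_iterate_def)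
    show "integrable M (f n)" if "n \<ge> 1" for n using assms(4) that .
    show "AE x in M. f (m + n) x \<le> f m (int_iterate M \<sigma> (int n) x) + f n x"
      if "m \<ge> 1" "n \<ge> 1" for m n
      using assms(5) that by (simp add: subadditive_sequence_def int_iterate_def)
  qed
  show ?thesis
  proof (intro exI[of _ growth_rate] conjI)
    have "growth_rate \<le> ereal (mean 1 / real 1)"
      unfolding growth_rate_def by (intro INF_lower) auto
    then show "growth_rate < \<infinity>" by (rule le_less_trans) simp
    show "(\<lambda>n. ereal ((1 / real n) * (\<integral>\<omega>. f n \<omega> \<partial>M))) \<longlonglongrightarrow> growth_rate"
      using integral_growth by (simp add: mean_def)
    show "AE \<omega> in M. (\<lambda>n. ereal ((1 / real (2 * n)) *
                f (2 * n) ((inv_into (space M) \<sigma> ^^ n) \<omega>))) \<longlonglongrightarrow> growth_rate"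
      using AE_symmetric_growth
    proof eventually_elim
      case (elim x)
      show ?case
      proof (rule Lim_transform_eventually[OF elim])
        show "\<forall>\<^sub>F n in sequentially. ereal (window x (-int n) (int n) / real (2 * n))
            = ereal ((1 / real (2 * n)) * f (2 * n) ((inv_into (space M) \<sigma> ^^ n) x))"
          using eventually_ge_at_top[of 1]
        proof eventually_elim
          case (elim n)
          then have "nat (int n - - int n) = 2 * n" by simp
          with elim show ?case by (simp add: window_def int_iterate_def)
        qed
      qed
    qed
  qed
qed

end
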